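(* Let $k>0$ be real and let $z,\gamma\in\mathbb{C}$ be such that all Gamma-function values involved are defined. Let $\langle z\rangle_{\gamma,k}=k^{\gamma}[z/k]^{\gamma}$ and $\langle z\rangle_{\gamma,-k}=k^{\gamma}[z/k]_{\gamma}$. Then $$\langle z\rangle_{\gamma,k}=(z+(\gamma-1)k)\,\langle z\rangle_{\gamma-1,k},\qquad \langle z\rangle_{\gamma,-k}=(z-(\gamma-1)k)\,\langle z\rangle_{\gamma-1,-k}.$$
   Context: For complex $w,\gamma$ set $[w]^{\gamma}:=\Gamma(w+\gamma)/\Gamma(w)$ and $[w]_{\gamma}:=\Gamma(w+1)/\Gamma(w-\gamma+1)$, where $\Gamma$ is the Euler Gamma function (a factor $1/\Gamma$ at a pole of $\Gamma$ is read as $0$; numerator Gamma values are required to be finite). Here $k^\gamma=e^{\gamma\ln k}$. *)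

theory Defs
  imports "HOL-Analysis.Analysis"
begin

text \<open>
  \<open>Gamma\<close> takes the value 0 at its poles (the non-positive integers) and has no zeros.  Since
  \<open>x / 0 = 0\<close>, a pole in the denominator of the quotients below makes them 0, which is the
  convention wanted for a factor \<open>1 / Gamma\<close>.  A pole in the numerator has no such meaning and has
  to be excluded by \<open>rising_defined\<close> and \<open>falling_defined\<close>.
\<close>

text \<open>$[w]^{\gamma}$ and $[w]_{\gamma}$\<close>

definition rising :: "complex \<Rightarrow> complex \<Rightarrow> complex" where
  "rising w \<gamma> = Gamma (w + \<gamma>) / Gamma w"

definition falling :: "complex \<Rightarrow> complex \<Rightarrow> complex" where
  "falling w \<gamma> = Gamma (w + 1) / Gamma (w - \<gamma> + 1)"

definition rising_defined :: "complex \<Rightarrow> complex \<Rightarrow> bool" where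
  "rising_defined w \<gamma> \<longleftrightarrow> w + \<gamma> \<notin> \<int>\<^sub>\<le>\<^sub>0"

text \<open>The numerator of \<open>falling w \<gamma>\<close> does not depend on \<open>\<gamma>\<close>.\<close>

definition falling_defined :: "complex \<Rightarrow> complex \<Rightarrow> bool" where
  "falling_defined w \<gamma> \<longleftrightarrow> w + 1 \<notin> \<int>\<^sub>\<le>\<^sub>0"

text \<open>
  $\langle z\rangle_{\gamma,k}$ and $\langle z\rangle_{\gamma,-k}$, where \<open>k > 0\<close> in both cases.
  For such \<open>k\<close>, \<open>of_real k powr \<gamma> = exp (\<gamma> * of_real (ln k))\<close>.
\<close>

definition k_rising :: "real \<Rightarrow> complex \<Rightarrow> complex \<Rightarrow> complex" where
  "k_rising k z \<gamma> = of_real k powr \<gamma> * rising (z / of_real k) \<gamma>"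

definition k_falling :: "real \<Rightarrow> complex \<Rightarrow> complex \<Rightarrow> complex" where
  "k_falling k z \<gamma> = of_real k powr \<gamma> * falling (z / of_real k) \<gamma>"

end

theory Submission
  imports Defs
begin

text \<open>
  Put \<open>w = z / k\<close>. Both recurrences are the functional equation of \<open>Gamma\<close> at a single argument:
  for the rising factorial it is applied to the numerator, which must avoid the poles, and for
  the falling factorial to the denominator, where it is read for the entire function
  \<open>rGamma = 1 / Gamma\<close> and so holds at the poles too. This gives the linear factors
  \<open>w + (\<gamma> - 1)\<close> and \<open>w - (\<gamma> - 1)\<close>; the extra factor \<open>k\<close> contained in \<open>k powr \<gamma>\<close>, compared with
  \<open>k powr (\<gamma> - 1)\<close>, rescales them to \<open>z + (\<gamma> - 1) k\<close> and \<open>z - (\<gamma> - 1) k\<close>.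
\<close>

lemma rising_rec:
  assumes "rising_defined w (\<gamma> - 1)"
  shows "rising w \<gamma> = (w + (\<gamma> - 1)) * rising w (\<gamma> - 1)"
  using Gamma_plus1[of "w + (\<gamma> - 1)"] assms
  by (simp add: rising_def rising_defined_def)

text \<open>
  The functional equation is used for \<open>rGamma\<close>, which covers the poles of the denominators: if
  \<open>w - \<gamma> + 1\<close> is a pole of \<open>Gamma\<close>, then either \<open>w - \<gamma> + 2\<close> is one too, or \<open>w - \<gamma> + 1 = 0\<close>
  and the linear factor vanishes.
\<close>

lemma falling_rec: "falling w \<gamma> = (w - (\<gamma> - 1)) * falling w (\<gamma> - 1)"
proof -
  have "rGamma (w - \<gamma> + 1) = (w - (\<gamma> - 1)) * rGamma (w - (\<gamma> - 1) + 1)"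
    using rGamma_plus1[of "w - (\<gamma> - 1)"] by (simp add: algebra_simps)
  then show ?thesis
    by (simp add: falling_def rGamma_inverse_Gamma divide_inverse)
qed

lemma powr_eq_mult_powr_minus_one:
  fixes x a :: complex
  assumes "x \<noteq> 0"
  shows "x powr a = x * x powr (a - 1)"
  using assms by (simp add: powr_diff)

theorem proposition1p3:
  fixes k :: real and z \<gamma> :: complex
  assumes "k > 0"
  shows "(rising_defined (z / of_real k) \<gamma> \<and> rising_defined (z / of_real k) (\<gamma> - 1) \<longrightarrow>
            k_rising k z \<gamma> = (z + (\<gamma> - 1) * of_real k) * k_rising k z (\<gamma> - 1)) \<and>
         (falling_defined (z / of_real k) \<gamma> \<and> falling_defined (z / of_real k) (\<gamma> - 1) \<longrightarrow>
            k_falling k z \<gamma> = (z - (\<gamma> - 1) * of_real k) * k_falling k z (\<gamma> - 1))"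
proof -
  define c where "c = complex_of_real k"
  define w where "w = z / c"
  have c: "c \<noteq> 0" using assms by (simp add: c_def)
  have z: "z = w * c" using c by (simp add: w_def)
  note powr = powr_eq_mult_powr_minus_one[OF c, of \<gamma>]
  have "k_rising k z \<gamma> = (z + (\<gamma> - 1) * c) * k_rising k z (\<gamma> - 1)"
    if "rising_defined w (\<gamma> - 1)"
  proof -
    have "k_rising k z \<gamma> = c powr \<gamma> * rising w \<gamma>"
      by (simp add: k_rising_def c_def w_def)
    also have "\<dots> = (w * c + (\<gamma> - 1) * c) * (c powr (\<gamma> - 1) * rising w (\<gamma> - 1))"
      unfolding powr rising_rec[OF that] by (simp only: ring_distribs mult_ac)
    also have "\<dots> = (z + (\<gamma> - 1) * c) * k_rising k z (\<gamma> - 1)"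
      unfolding z[symmetric] by (simp add: k_rising_def c_def w_def)
    finally show ?thesis .
  qed
  moreover have "k_falling k z \<gamma> = (z - (\<gamma> - 1) * c) * k_falling k z (\<gamma> - 1)"
  proof -
    have "k_falling k z \<gamma> = c powr \<gamma> * falling w \<gamma>"
      by (simp add: k_falling_def c_def w_def)
    also have "\<dots> = (w * c - (\<gamma> - 1) * c) * (c powr (\<gamma> - 1) * falling w (\<gamma> - 1))"
      unfolding powr falling_rec[of w \<gamma>] left_diff_distrib[symmetric] by (simp only: mult_ac)
    also have "\<dots> = (z - (\<gamma> - 1) * c) * k_falling k z (\<gamma> - 1)"
      unfolding z[symmetric] by (simp add: k_falling_def c_def w_def)
    finally show ?thesis .
  qed
  ultimately show ?thesis
    unfolding c_def w_def by blast
qed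

end
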